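(* Let $S=(\alpha^*\beta^*,\{\alpha,\beta\},\alpha<\beta)$. Let $\mathbf{w}_1\in\{0,1\}^{\mathbb{N}}$ be the characteristic sequence of the set of triangular numbers $\{n(n+1)/2\mid n\ge 0\}$, i.e. $\mathbf{w}_1[k]=1$ if and only if $k=n(n+1)/2$ for some $n\ge 0$. Then $\mathbf{w}_1$ is $S$-automatic, and its boundary sequence $\partial_{\mathbf{w}_1}$ is $S$-automatic. In particular, $\partial_{\mathbf{w}_1}$ is constant.
   Context: For an infinite word $\mathbf{x}$ over a finite alphabet $B$ (indexed from $0$), the boundary sequence is $\partial_{\mathbf{x}}=(\partial_{\mathbf{x}}[n])_{n\ge 1}$ with $\partial_{\mathbf{x}}[n]=\{(\mathbf{x}[i],\mathbf{x}[i+n])\mid i\ge 0\}\subseteq B\times B$. An abstract numeration system is a triple $S=(L,A,<)$ where $L$ is an infinite regular language over a finite alphabet $A$ totally ordered by $<$. Order $L$ genealogically (first by length, then lexicographically); $\mathrm{rep}_S(n)$ is the $(n+1)$st word of $L$ for $n\ge 0$. A deterministic finite automaton with output (DFAO) is a DFA with an output map $\tau$ from its state set to a finite alphabet; its output $\mathcal{A}(w)$ on a word $w$ is $\tau(q)$ with $q$ the state reached by reading $w$ from the initial state. A sequence $\mathbf{y}$ is $S$-automatic if there is a DFAO $\mathcal{A}$ with $\mathbf{y}[n]=\mathcal{A}(\mathrm{rep}_S(n))$ for all $n$ for which $\mathbf{y}[n]$ is defined. *)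

theory Defs
  imports Main
begin

section \<open>Deterministic automata, with and without output\<close>

record ('q, 'a) automaton =
  states :: "'q set"
  init :: 'q
  step :: "'q \<Rightarrow> 'a \<Rightarrow> 'q"

definition automaton_over :: "'a set \<Rightarrow> ('q, 'a, 'z) automaton_scheme \<Rightarrow> bool" where
  "automaton_over A M \<longleftrightarrow>
     finite (states M) \<and> init M \<in> states M \<and> (\<forall>q\<in>states M. \<forall>a\<in>A. step M q a \<in> states M)"

definition run :: "('q, 'a, 'z) automaton_scheme \<Rightarrow> 'a list \<Rightarrow> 'q" where
  "run M w = foldl (step M) (init M) w"

record ('q, 'a, 'b) dfao = "('q, 'a) automaton" +
  outputs :: "'b set"
  out :: "'q \<Rightarrow> 'b"

definition dfao_over :: "'a set \<Rightarrow> ('q, 'a, 'b) dfao \<Rightarrow> bool" where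
  "dfao_over A M \<longleftrightarrow>
     automaton_over A M \<and> finite (outputs M) \<and> (\<forall>q\<in>states M. out M q \<in> outputs M)"

text \<open>State sets are finite, so taking natural numbers as states, here and in
  \<open>automatic_on\<close> below, loses no generality.\<close>

definition regular_over :: "'a set \<Rightarrow> 'a list set \<Rightarrow> bool" where
  "regular_over A L \<longleftrightarrow>
     (\<exists>(M :: (nat, 'a) automaton) F. automaton_over A M \<and> F \<subseteq> states M \<and>
        L = {w \<in> lists A. run M w \<in> F})"


section \<open>Abstract numeration systems\<close>

text \<open>A triple \<open>(L, A, r)\<close>, where \<open>r\<close> is the strict order on the alphabet:
  \<open>(a, b) \<in> r\<close> means \<open>a < b\<close>.\<close>

type_synonym 'a numeration_system = "'a list set \<times> 'a set \<times> ('a \<times> 'a) set"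

definition abstract_numeration_system :: "'a numeration_system \<Rightarrow> bool" where
  "abstract_numeration_system S \<longleftrightarrow> (case S of (L, A, r) \<Rightarrow>
     finite A \<and> r \<subseteq> A \<times> A \<and> strict_linear_order_on A r \<and> regular_over A L \<and> infinite L)"

text \<open>\<open>lenlex r\<close> is the strict genealogical order. The \<open>(n+1)\<close>st word is the one with
  exactly \<open>n\<close> predecessors in \<open>L\<close>; every word has finitely many, as \<open>A\<close> is finite.\<close>

definition rep :: "'a numeration_system \<Rightarrow> nat \<Rightarrow> 'a list" where
  "rep S n = (case S of (L, A, r) \<Rightarrow>
     (THE w. w \<in> L \<and> card {v \<in> L. (v, w) \<in> lenlex r} = n))"

text \<open>\<open>I\<close> is the set of indices at which the sequence \<open>y\<close> is defined; values of \<open>y\<close>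
  outside \<open>I\<close> are irrelevant.\<close>

definition automatic_on :: "'a numeration_system \<Rightarrow> nat set \<Rightarrow> (nat \<Rightarrow> 'b) \<Rightarrow> bool" where
  "automatic_on S I y \<longleftrightarrow> (case S of (L, A, r) \<Rightarrow>
     (\<exists>M :: (nat, 'a, 'b) dfao. dfao_over A M \<and> (\<forall>n\<in>I. y n = out M (run M (rep S n)))))"


section \<open>Boundary sequences\<close>

text \<open>Only the values at \<open>n \<ge> 1\<close> form the boundary sequence.\<close>

definition boundary :: "(nat \<Rightarrow> 'b) \<Rightarrow> nat \<Rightarrow> ('b \<times> 'b) set" where
  "boundary x n = {(x i, x (i + n)) | i. True}"


section \<open>The system and the word considered\<close>

datatype letter = Alpha | Beta

definition S_ab :: "letter numeration_system" where
  "S_ab = ({replicate i Alpha @ replicate j Beta | i j. True}, {Alpha, Beta}, {(Alpha, Beta)})"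

definition w1 :: "nat \<Rightarrow> nat" where
  "w1 k = (if \<exists>n. k = n * (n + 1) div 2 then 1 else 0)"


subsection \<open>\<open>S_ab\<close> is an abstract numeration system\<close>

definition ab_automaton :: "(nat, letter) automaton" where
  "ab_automaton = \<lparr>states = {0, 1, 2}, init = 0,
     step = (\<lambda>q a. if q = 0 then (if a = Alpha then 0 else 1)
                    else if q = 1 \<and> a = Beta then 1 else 2)\<rparr>"

lemma run_ab_snoc: "run ab_automaton (w @ [a]) = step ab_automaton (run ab_automaton w) a"
  by (simp add: run_def)

lemma run_ab_characterization:
  "(run ab_automaton w = 0 \<longleftrightarrow> (\<exists>i. w = replicate i Alpha)) \<and>
   (run ab_automaton w = 1 \<longleftrightarrow> (\<exists>i j. w = replicate i Alpha @ replicate (Suc j) Beta))"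
proof (induction w rule: rev_induct)
  case Nil
  show ?case by (simp add: run_def ab_automaton_def)
next
  case (snoc a w)
  have A0: "(\<exists>i. w @ [a] = replicate i Alpha) \<longleftrightarrow> a = Alpha \<and> (\<exists>i. w = replicate i Alpha)"
  proof
    assume "\<exists>i. w @ [a] = replicate i Alpha"
    then obtain i where i: "w @ [a] = replicate i Alpha" by blast
    then obtain k where "i = Suc k" by (cases i) auto
    then show "a = Alpha \<and> (\<exists>i. w = replicate i Alpha)"
      using i by (auto simp: replicate_append_same[symmetric])
  next
    assume "a = Alpha \<and> (\<exists>i. w = replicate i Alpha)"
    then obtain i where "a = Alpha" "w = replicate i Alpha" by blast
    then have "w @ [a] = replicate (Suc i) Alpha" by (simp add: replicate_append_same)
    then show "\<exists>i. w @ [a] = replicate i Alpha" by blast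
  qed
  have A1: "(\<exists>i j. w @ [a] = replicate i Alpha @ replicate (Suc j) Beta) \<longleftrightarrow>
     a = Beta \<and> (\<exists>i j. w = replicate i Alpha @ replicate j Beta)"
    unfolding replicate_Suc replicate_append_same[symmetric] append_assoc[symmetric] by auto
  have A2: "(\<exists>i j. w = replicate i Alpha @ replicate j Beta) \<longleftrightarrow>
     (\<exists>i. w = replicate i Alpha) \<or> (\<exists>i j. w = replicate i Alpha @ replicate (Suc j) Beta)"
  proof
    assume "\<exists>i j. w = replicate i Alpha @ replicate j Beta"
    then obtain i j where "w = replicate i Alpha @ replicate j Beta" by blast
    then show "(\<exists>i. w = replicate i Alpha) \<or>
        (\<exists>i j. w = replicate i Alpha @ replicate (Suc j) Beta)"
      by (cases j) auto
  next
    assume "(\<exists>i. w = replicate i Alpha) \<or>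
        (\<exists>i j. w = replicate i Alpha @ replicate (Suc j) Beta)"
    then show "\<exists>i j. w = replicate i Alpha @ replicate j Beta"
      by (metis append_Nil2 replicate_0)
  qed
  show ?case
    unfolding A0 A1 A2 run_ab_snoc using snoc.IH
    by (cases a) (simp_all add: ab_automaton_def split: if_splits)
qed

lemma S_ab_language_eq:
  "{replicate i Alpha @ replicate j Beta | i j. True} =
     {w \<in> lists {Alpha, Beta}. run ab_automaton w \<in> {0, 1}}"
proof -
  have "lists {Alpha, Beta} = UNIV"
    using letter.exhaust by (auto simp: lists_eq_set)
  moreover have "(\<exists>i j. w = replicate i Alpha @ replicate j Beta) \<longleftrightarrow>
     (\<exists>i. w = replicate i Alpha) \<or> (\<exists>i j. w = replicate i Alpha @ replicate (Suc j) Beta)" for w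
    by (metis append_Nil2 replicate_0 not0_implies_Suc)
  ultimately show ?thesis
    by (simp only: run_ab_characterization insert_iff empty_iff simp_thms) auto
qed

lemma infinite_S_ab_language: "infinite {replicate i Alpha @ replicate j Beta | i j. True}"
proof -
  have "inj (\<lambda>i. replicate i Alpha)"
    by (metis injI length_replicate)
  then have "infinite (range (\<lambda>i. replicate i Alpha))"
    using finite_imageD infinite_UNIV_nat by blast
  moreover have "range (\<lambda>i. replicate i Alpha) \<subseteq> {replicate i Alpha @ replicate j Beta | i j. True}"
    by (force intro: exI[of _ "0 :: nat"])
  ultimately show ?thesis
    by (rule infinite_super[rotated])
qed

lemma abstract_numeration_system_S_ab: "abstract_numeration_system S_ab"
proof -
  have "automaton_over {Alpha, Beta} ab_automaton"
    by (simp add: automaton_over_def ab_automaton_def)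
  moreover have "{0, 1} \<subseteq> states ab_automaton"
    by (simp add: ab_automaton_def)
  ultimately have "regular_over {Alpha, Beta} {replicate i Alpha @ replicate j Beta | i j. True}"
    unfolding regular_over_def using S_ab_language_eq by blast
  moreover have "strict_linear_order_on {Alpha, Beta} {(Alpha, Beta)}"
    by (simp add: strict_linear_order_on_def trans_def irrefl_def total_on_def)
  ultimately show ?thesis
    using infinite_S_ab_language by (simp add: abstract_numeration_system_def S_ab_def)
qed

end

theory Submission
  imports Defs "HOL-Library.Nat_Bijection"
begin

text \<open>
  In genealogical order the words of length \<open>l\<close> in \<open>\<alpha>\<^sup>*\<beta>\<^sup>*\<close> are
  \<open>\<alpha>\<^sup>l < \<alpha>\<^sup>l\<^sup>-\<^sup>1\<beta> < \<dots> < \<beta>\<^sup>l\<close>, so \<open>\<alpha>\<^sup>n\<beta>\<^sup>m\<close> has number \<open>T\<^sub>n\<^sub>+\<^sub>m + m\<close>: this is Cantor's pairing of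
  \<open>m\<close> and \<open>n\<close>. Hence the triangular numbers are represented by the words without \<open>\<beta>\<close>.
  Every pair over \<open>{0, 1}\<close> occurs at every distance \<open>n \<ge> 1\<close>: the numbers \<open>T\<^sub>n\<^sub>-\<^sub>1\<close> and \<open>T\<^sub>n\<close> differ
  by \<open>n\<close>, and the gaps between large triangular numbers exceed \<open>n + 1\<close>.
\<close>

lemma strict_mono_triangle: "strict_mono triangle"
  by (simp add: strict_mono_Suc_iff)

text \<open>Since \<open>prod_encode (m, n) = triangle (m + n) + m\<close> and m \<le> m + n, the
  codes of the pairs with sum s lie in the block from \<open>triangle s\<close> up to, but
  excluding, \<open>triangle (Suc s)\<close>.\<close>

lemma prod_encode_less_iff:
  "prod_encode (m, n) < prod_encode (m', n') \<longleftrightarrow> m + n < m' + n' \<or> m + n = m' + n' \<and> m < m'"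
proof -
  have less: "prod_encode (i, j) < prod_encode (i', j')" if "i + j < i' + j'" for i j i' j'
  proof -
    have "prod_encode (i, j) < triangle (Suc (i + j))"
      by (simp add: prod_encode_def)
    also have "\<dots> \<le> triangle (i' + j')"
      using that by (intro monoD[OF strict_mono_mono[OF strict_mono_triangle]]) simp
    also have "\<dots> \<le> prod_encode (i', j')"
      by (simp add: prod_encode_def)
    finally show ?thesis .
  qed
  consider "m + n < m' + n'" | "m' + n' < m + n" | "m + n = m' + n'"
    by linarith
  then show ?thesis
  proof cases
    case 1
    then show ?thesis using less by simp
  next
    case 2
    then show ?thesis using less[OF 2] by simp
  next
    case 3
    then show ?thesis by (simp add: prod_encode_def)
  qed
qed

lemma lenlex_Alpha_Beta_words:
  assumes "prod_encode (m, n) < prod_encode (m', n')"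
  shows "(replicate n Alpha @ replicate m Beta, replicate n' Alpha @ replicate m' Beta)
    \<in> lenlex {(Alpha, Beta)}"
proof -
  consider "m + n < m' + n'" | "m + n = m' + n'" "m < m'"
    using assms by (auto simp: prod_encode_less_iff)
  then show ?thesis
  proof cases
    case 1
    then show ?thesis by (simp add: lenlex_conv add.commute)
  next
    case 2
    \<comment> \<open>At equal length the words share the prefix of n' letters \<open>Alpha\<close>;
      right after it the first word has the first of its d further \<open>Alpha\<close>s and the
      second already has \<open>Beta\<close>.\<close>
    define d where "d = m' - m"
    have eq: "n = n' + d" "m' = d + m" and "d > 0"
      using 2 by (simp_all add: d_def)
    then obtain k where k: "d = Suc k"
      by (cases d) auto
    have "(Alpha # replicate k Alpha @ replicate m Beta, Beta # replicate (k + m) Beta)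
        \<in> lex {(Alpha, Beta)}"
      by simp
    then have "(replicate n' Alpha @ Alpha # replicate k Alpha @ replicate m Beta,
        replicate n' Alpha @ Beta # replicate (k + m) Beta) \<in> lex {(Alpha, Beta)}"
      by (rule lex_append_leftI)
    then show ?thesis
      by (simp add: lenlex_conv eq k replicate_add replicate_app_Cons_same)
  qed
qed

text \<open>The converse comes from the total order on codes: a larger or equal code on the left
  would contradict asymmetry of \<open>lenlex\<close>.\<close>

lemma lenlex_Alpha_Beta_words_iff:
  "(replicate n Alpha @ replicate m Beta, replicate n' Alpha @ replicate m' Beta)
     \<in> lenlex {(Alpha, Beta)} \<longleftrightarrow> prod_encode (m, n) < prod_encode (m', n')"
proof
  let ?r = "lenlex {(Alpha, Beta)}"
  assume *: "(replicate n Alpha @ replicate m Beta, replicate n' Alpha @ replicate m' Beta) \<in> ?r"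
  have "wf ?r"
    by (simp add: wf_lenlex)
  then have "asym ?r"
    by (rule wf_imp_asym)
  then have "\<not> prod_encode (m', n') < prod_encode (m, n)" "(m, n) \<noteq> (m', n')"
    using * lenlex_Alpha_Beta_words[of m' n' m n] by (auto dest: asymD)
  moreover from this have "prod_encode (m, n) \<noteq> prod_encode (m', n')"
    by (simp add: prod_encode_eq)
  ultimately show "prod_encode (m, n) < prod_encode (m', n')"
    by linarith
qed (rule lenlex_Alpha_Beta_words)

lemma card_predecessors_S_ab:
  "card {v \<in> {replicate i Alpha @ replicate j Beta | i j. True}.
       (v, replicate n Alpha @ replicate m Beta) \<in> lenlex {(Alpha, Beta)}} = prod_encode (m, n)"
proof -
  let ?word = "\<lambda>(m, n). replicate n Alpha @ replicate m Beta"
  have "{v \<in> {replicate i Alpha @ replicate j Beta | i j. True}.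
      (v, replicate n Alpha @ replicate m Beta) \<in> lenlex {(Alpha, Beta)}}
    = (?word \<circ> prod_decode) ` {..<prod_encode (m, n)}" (is "?A = ?B")
  proof
    show "?A \<subseteq> ?B"
    proof
      fix v assume "v \<in> ?A"
      then obtain i j where v: "v = replicate i Alpha @ replicate j Beta"
        and "prod_encode (j, i) < prod_encode (m, n)"
        by (auto simp: lenlex_Alpha_Beta_words_iff)
      then show "v \<in> ?B"
        by (intro image_eqI[where x = "prod_encode (j, i)"]) simp_all
    qed
    show "?B \<subseteq> ?A"
    proof
      fix v assume "v \<in> ?B"
      then obtain k where k: "k < prod_encode (m, n)" and v: "v = ?word (prod_decode k)"
        by auto
      obtain j i where ji: "prod_decode k = (j, i)"
        by fastforce
      then have "k = prod_encode (j, i)"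
        by (metis prod_decode_inverse)
      then show "v \<in> ?A"
        using k v ji by (auto simp: lenlex_Alpha_Beta_words_iff)
    qed
  qed
  moreover have "inj ?word"
  proof (rule injI)
    fix p q assume eq: "?word p = ?word q"
    obtain m n m' n' where pq: "p = (m, n)" "q = (m', n')"
      by fastforce
    \<comment> \<open>If equal words had different codes, the equivalence would place a word
      strictly below itself.\<close>
    have "\<not> prod_encode p < prod_encode q" "\<not> prod_encode q < prod_encode p"
      using eq lenlex_Alpha_Beta_words_iff[of n m n' m'] lenlex_Alpha_Beta_words_iff[of n' m' n m]
        lenlex_Alpha_Beta_words_iff[of n m n m]
      by (simp_all add: pq)
    then show "p = q"
      by (metis linorder_neqE_nat prod_encode_eq)
  qed
  then have "inj_on (?word \<circ> prod_decode) {..<prod_encode (m, n)}"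
    using inj_prod_decode by (intro inj_on_subset[OF inj_compose]) simp_all
  ultimately show ?thesis
    by (simp only: card_image card_lessThan)
qed

lemma rep_S_ab: "rep S_ab (prod_encode (m, n)) = replicate n Alpha @ replicate m Beta"
  unfolding rep_def S_ab_def prod.case
proof (rule the_equality)
  fix w
  assume w: "w \<in> {replicate i Alpha @ replicate j Beta | i j. True} \<and>
    card {v \<in> {replicate i Alpha @ replicate j Beta | i j. True}.
      (v, w) \<in> lenlex {(Alpha, Beta)}} = prod_encode (m, n)"
  then obtain i j where ij: "w = replicate i Alpha @ replicate j Beta"
    by blast
  have "prod_encode (j, i) = prod_encode (m, n)"
    using w unfolding ij card_predecessors_S_ab by (rule conjunct2)
  then show "w = replicate n Alpha @ replicate m Beta"
    by (simp add: prod_encode_eq ij)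
qed (rule conjI[OF _ card_predecessors_S_ab], blast)

lemma w1_eq: "w1 k = (if k \<in> range triangle then 1 else 0)"
  by (auto simp: w1_def triangle_def)

lemma w1_triangle: "w1 (triangle n) = 1"
  by (simp add: w1_eq)

lemma w1_between_triangles:
  assumes "triangle m < k" "k < triangle (Suc m)"
  shows "w1 k = 0"
proof -
  have "k \<noteq> triangle n" for n
    using assms strict_mono_less[OF strict_mono_triangle] by (metis not_less_eq)
  then show ?thesis
    by (auto simp: w1_eq)
qed

text \<open>For m > 0 the code lies strictly between \<open>triangle (m + n)\<close> and
  \<open>triangle (m + n) + m + n + 1\<close>, the next triangular number.\<close>

lemma w1_prod_encode: "w1 (prod_encode (m, n)) = (if m = 0 then 1 else 0)"
proof (cases "m = 0")
  case True
  then show ?thesis by (simp add: prod_encode_def w1_triangle)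
next
  case False
  then show ?thesis
    by (simp add: prod_encode_def w1_between_triangles[of "m + n"])
qed

lemma boundary_w1:
  assumes "n \<ge> 1"
  shows "boundary w1 n = {0, 1} \<times> {0, 1}"
proof
  show "boundary w1 n \<subseteq> {0, 1} \<times> {0, 1}"
    by (auto simp: boundary_def w1_def)
  have mem: "(w1 i, w1 (i + n)) \<in> boundary w1 n" for i
    by (auto simp: boundary_def)
  have "triangle (n - 1) + n = triangle n"
    using assms by (cases n) auto
  then have "(1, 1) \<in> boundary w1 n"
    using mem[of "triangle (n - 1)"] by (simp add: w1_triangle)
  \<comment> \<open>\<open>triangle n + n\<close> is the last number before
    \<open>triangle (Suc n)\<close>.\<close>
  moreover have "(1, 0) \<in> boundary w1 n"
    using mem[of "triangle n"] assms by (simp add: w1_triangle w1_between_triangles[of n])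
  moreover have "(0, 1) \<in> boundary w1 n"
    using mem[of "triangle n + 1"] assms
      w1_between_triangles[of n "triangle n + 1"] w1_triangle[of "Suc n"]
    by simp
  \<comment> \<open>The gap above \<open>triangle (Suc n)\<close> has n + 1 interior points, so its
    first and last are at distance n; the gap above \<open>triangle n\<close> would be one too
    short.\<close>
  moreover have "(0, 0) \<in> boundary w1 n"
    using mem[of "triangle (Suc n) + 1"] assms
      w1_between_triangles[of "Suc n" "triangle (Suc n) + 1"]
      w1_between_triangles[of "Suc n" "triangle (Suc n) + 1 + n"]
    by simp
  ultimately show "{0, 1} \<times> {0, 1} \<subseteq> boundary w1 n"
    by auto
qed

lemma automatic_on_const:
  assumes "\<And>n. n \<in> I \<Longrightarrow> y n = c"
  shows "automatic_on S I y"
proof -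
  obtain L A r where S: "S = (L, A, r)"
    by (cases S)
  let ?M = "\<lparr>states = {0 :: nat}, init = 0, step = \<lambda>_ _. 0, outputs = {c}, out = \<lambda>_. c\<rparr>"
  have "dfao_over A ?M"
    by (simp add: dfao_over_def automaton_over_def)
  with assms show ?thesis
    unfolding automatic_on_def S by (intro case_prodI exI[of _ ?M]) simp
qed

lemma automatic_w1: "automatic_on S_ab UNIV w1"
proof -
  \<comment> \<open>State 1 is absorbing and records that a \<open>Beta\<close> has been read; state
    0 thus means m = 0.\<close>
  define M :: "(nat, letter, nat) dfao" where
    "M = \<lparr>states = {0, 1}, init = 0, step = \<lambda>q a. if a = Alpha then q else 1,
       outputs = {0, 1}, out = \<lambda>q. if q = 0 then 1 else 0\<rparr>"
  have "dfao_over {Alpha, Beta} M"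
    by (simp add: dfao_over_def automaton_over_def M_def)
  moreover have "w1 k = out M (run M (rep S_ab k))" for k
  proof -
    obtain m n where k: "k = prod_encode (m, n)"
      by (metis prod_decode_inverse surj_pair)
    have "foldl (step M) q (replicate n Alpha) = q" for q
      by (induction n) (simp_all add: M_def)
    moreover have "foldl (step M) q (replicate m Beta) = (if m = 0 then q else 1)" for q
      by (induction m arbitrary: q) (simp_all add: M_def)
    ultimately have "run M (rep S_ab k) = (if m = 0 then init M else 1)"
      by (simp add: k rep_S_ab run_def)
    moreover have "init M = 0" "out M 0 = 1" "out M 1 = 0"
      by (simp_all add: M_def)
    ultimately show ?thesis
      by (simp add: k w1_prod_encode)
  qed
  ultimately show ?thesis
    unfolding automatic_on_def S_ab_def prod.case by blast
qed

theorem proposition3p4: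
  shows "automatic_on S_ab UNIV w1 \<and>
    automatic_on S_ab {1..} (boundary w1) \<and>
    (\<exists>c. \<forall>n\<ge>1. boundary w1 n = c)"
proof (intro conjI)
  show "automatic_on S_ab {1..} (boundary w1)"
    by (rule automatic_on_const) (simp add: boundary_w1)
  show "\<exists>c. \<forall>n\<ge>1. boundary w1 n = c"
    using boundary_w1 by blast
qed (rule automatic_w1)

end
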